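(* There is a map of monads $\sigma:\mathcal{D}\Rightarrow\mathcal{E}$ from the distribution monad to the expectation monad, given by $$\sigma_X(\varphi)=\lambda p\in[0,1]^X.\ \sum_{x}\varphi(x)\cdot p(x).$$ All components $\sigma_X:\mathcal{D}(X)\to\mathcal{E}(X)$ are injections, and for each finite set $X$ the component $\sigma_X:\mathcal{D}(X)\to\mathcal{E}(X)$ is an isomorphism (bijection).
   Context: Effect algebra: a set $E$ with a partial commutative associative operation $\oplus$ with neutral element $0$ and a map $(-)^\perp$ such that, with $1:=0^\perp$, $x^\perp$ is the unique element with $x\oplus x^\perp=1$, and $x\oplus 1$ is defined only if $x=0$. Effect module: an effect algebra with scalar multiplication $[0,1]\times E\to E$ with $1x=x$, $(rs)x=r(sx)$, $(r+s)x=rx\oplus sx$ if $r+s\le1$, and $r(x\oplus y)=rx\oplus ry$ if $x\oplus y$ is defined. Category $\mathbf{EMod}$: maps preserve $1$, defined sums $\oplus$, and scalar multiplication. $[0,1]^X$ is an effect module pointwise ($p\oplus q=p+q$ defined iff $p+q\le1$ pointwise). Expectation monad on $\mathbf{Sets}$: $\mathcal{E}(X)=\mathbf{EMod}([0,1]^X,[0,1])$, $\mathcal{E}(f)(h)(p)=h(p\circ f)$, unit $\eta(x)(p)=p(x)$, multiplication $\mu(h)(p)=h(\lambda k\in\mathcal{E}(X).\,k(p))$. Distribution monad on $\mathbf{Sets}$: $\mathcal{D}(X)$ is the set of functions $\varphi:X\to[0,1]$ with finite support and $\sum_x\varphi(x)=1$; $\mathcal{D}(f)(\varphi)(y)=\sum_{x\in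 f^{-1}(y)}\varphi(x)$; unit the Dirac distribution; multiplication $\mu(\Psi)(y)=\sum_{\varphi}\Psi(\varphi)\cdot\varphi(y)$. A map of monads is a natural transformation commuting with units and multiplications. *)

theory Defs
  imports Complex_Main "HOL-Library.FuncSet"
begin

section \<open>Effect algebras and effect modules\<close>

text \<open>The partial sum is option-valued: \<open>osum M x y = None\<close> means that the sum of \<open>x\<close> and \<open>y\<close>
  is not defined.  Values of the operations outside the carrier are irrelevant.\<close>

record 'a effect_algebra =
  carrier :: "'a set"
  ozero :: "'a"
  osum :: "'a \<Rightarrow> 'a \<Rightarrow> 'a option"
  perp :: "'a \<Rightarrow> 'a"

definition oone :: "('a, 'm) effect_algebra_scheme \<Rightarrow> 'a" where
  "oone M = perp M (ozero M)"

text \<open>Commutativity and associativity are Kleene equalities: one side is defined iff the other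
  side is, and then they agree.\<close>

locale effect_algebra =
  fixes M :: "('a, 'm) effect_algebra_scheme"
  assumes zero_closed: "ozero M \<in> carrier M"
    and perp_closed: "x \<in> carrier M \<Longrightarrow> perp M x \<in> carrier M"
    and sum_closed:
      "\<lbrakk>x \<in> carrier M; y \<in> carrier M; osum M x y = Some z\<rbrakk> \<Longrightarrow> z \<in> carrier M"
    and sum_commute:
      "\<lbrakk>x \<in> carrier M; y \<in> carrier M\<rbrakk> \<Longrightarrow> osum M x y = osum M y x"
    and sum_assoc:
      "\<lbrakk>x \<in> carrier M; y \<in> carrier M; z \<in> carrier M\<rbrakk> \<Longrightarrow>
        Option.bind (osum M y z) (\<lambda>u. osum M x u) = Option.bind (osum M x y) (\<lambda>u. osum M u z)"
    and sum_zero: "x \<in> carrier M \<Longrightarrow> osum M x (ozero M) = Some x"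
    and sum_perp: "x \<in> carrier M \<Longrightarrow> osum M x (perp M x) = Some (oone M)"
    and perp_unique:
      "\<lbrakk>x \<in> carrier M; y \<in> carrier M; osum M x y = Some (oone M)\<rbrakk> \<Longrightarrow> y = perp M x"
    and sum_one: "\<lbrakk>x \<in> carrier M; osum M x (oone M) \<noteq> None\<rbrakk> \<Longrightarrow> x = ozero M"

record 'a effect_module = "'a effect_algebra" +
  scale :: "real \<Rightarrow> 'a \<Rightarrow> 'a"

locale effect_module = effect_algebra M
  for M :: "('a, 'm) effect_module_scheme" +
  assumes scale_closed: "\<lbrakk>r \<in> {0..1}; x \<in> carrier M\<rbrakk> \<Longrightarrow> scale M r x \<in> carrier M"
    and scale_one: "x \<in> carrier M \<Longrightarrow> scale M 1 x = x"
    and scale_scale: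
      "\<lbrakk>r \<in> {0..1}; s \<in> {0..1}; x \<in> carrier M\<rbrakk> \<Longrightarrow> scale M (r * s) x = scale M r (scale M s x)"
    and scale_add:
      "\<lbrakk>r \<in> {0..1}; s \<in> {0..1}; r + s \<le> 1; x \<in> carrier M\<rbrakk> \<Longrightarrow>
        osum M (scale M r x) (scale M s x) = Some (scale M (r + s) x)"
    and scale_sum:
      "\<lbrakk>r \<in> {0..1}; x \<in> carrier M; y \<in> carrier M; osum M x y = Some z\<rbrakk> \<Longrightarrow>
        osum M (scale M r x) (scale M r y) = Some (scale M r z)"

text \<open>Functions between carriers are represented by functions that are \<open>undefined\<close> outside their
  domain, so that equality of maps is equality in HOL.\<close>

definition EMod ::
  "('a, 'm) effect_module_scheme \<Rightarrow> ('b, 'n) effect_module_scheme \<Rightarrow> ('a \<Rightarrow> 'b) set" where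
  "EMod M N = {h \<in> carrier M \<rightarrow>\<^sub>E carrier N.
     h (oone M) = oone N \<and>
     (\<forall>x\<in>carrier M. \<forall>y\<in>carrier M. \<forall>z. osum M x y = Some z \<longrightarrow> osum N (h x) (h y) = Some (h z)) \<and>
     (\<forall>r\<in>{0..1}. \<forall>x\<in>carrier M. h (scale M r x) = scale N r (h x))}"

definition unit_interval :: "real effect_module" where
  "unit_interval = \<lparr>carrier = {0..1}, ozero = 0,
     osum = (\<lambda>x y. if x + y \<le> 1 then Some (x + y) else None),
     perp = (\<lambda>x. 1 - x), scale = (\<lambda>r x. r * x)\<rparr>"

definition predicates :: "'a set \<Rightarrow> ('a \<Rightarrow> real) effect_module" where
  "predicates X = \<lparr>carrier = X \<rightarrow>\<^sub>E {0..1}, ozero = (\<lambda>x\<in>X. 0),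
     osum = (\<lambda>p q. if \<forall>x\<in>X. p x + q x \<le> 1 then Some (\<lambda>x\<in>X. p x + q x) else None),
     perp = (\<lambda>p. \<lambda>x\<in>X. 1 - p x), scale = (\<lambda>r p. \<lambda>x\<in>X. r * p x)\<rparr>"

lemma effect_module_unit_interval: "effect_module unit_interval"
proof unfold_locales
  fix r x :: real assume "r \<in> {0..1}" "x \<in> carrier unit_interval"
  then show "scale unit_interval r x \<in> carrier unit_interval"
    by (auto simp: unit_interval_def mult_le_one)
next
  fix r x y z :: real assume *: "r \<in> {0..1}" "x \<in> carrier unit_interval" "y \<in> carrier unit_interval"
    "osum unit_interval x y = Some z"
  then have "r * (x + y) \<le> 1"
    by (intro mult_le_one) (auto simp: unit_interval_def split: if_splits)
  with * show "osum unit_interval (scale unit_interval r x) (scale unit_interval r y)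
      = Some (scale unit_interval r z)"
    by (auto simp: unit_interval_def algebra_simps split: if_splits)
next
  fix r s x :: real assume "r \<in> {0..1}" "s \<in> {0..1}" "r + s \<le> 1" and "x \<in> carrier unit_interval"
  moreover from this have "(r + s) * x \<le> 1"
    by (intro mult_le_one) (auto simp: unit_interval_def)
  ultimately show "osum unit_interval (scale unit_interval r x) (scale unit_interval s x)
      = Some (scale unit_interval (r + s) x)"
    by (auto simp: unit_interval_def algebra_simps)
qed (auto simp: unit_interval_def oone_def split: if_splits)

lemma effect_module_predicates: "effect_module (predicates X)"
proof unfold_locales
  fix r :: real and p assume "r \<in> {0..1}" "p \<in> carrier (predicates X)"
  then show "scale (predicates X) r p \<in> carrier (predicates X)"
    by (auto simp: predicates_def PiE_iff mult_le_one)
next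
  fix r :: real and p q s
  assume *: "r \<in> {0..1}" "p \<in> carrier (predicates X)" "q \<in> carrier (predicates X)"
    "osum (predicates X) p q = Some s"
  then have "r * (p x + q x) \<le> 1" if "x \<in> X" for x
    using that by (intro mult_le_one) (auto simp: predicates_def PiE_iff split: if_splits)
  with * show "osum (predicates X) (scale (predicates X) r p) (scale (predicates X) r q)
      = Some (scale (predicates X) r s)"
    by (auto simp: predicates_def fun_eq_iff simp flip: distrib_left split: if_splits)
next
  fix r s :: real and p
  assume *: "r \<in> {0..1}" "s \<in> {0..1}" "r + s \<le> 1" "p \<in> carrier (predicates X)"
  then have "(r + s) * p x \<le> 1" if "x \<in> X" for x
    using that by (intro mult_le_one) (auto simp: predicates_def PiE_iff)
  with * show "osum (predicates X) (scale (predicates X) r p) (scale (predicates X) s p)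
      = Some (scale (predicates X) (r + s) p)"
    by (auto simp: predicates_def fun_eq_iff simp flip: distrib_right)
next
  fix p q s
  assume *: "p \<in> carrier (predicates X)" "q \<in> carrier (predicates X)" "s \<in> carrier (predicates X)"
  have "p x + q x \<le> 1" if "x \<in> X" "p x + (q x + s x) \<le> 1" for x
    using * that by (force simp: predicates_def PiE_iff)
  moreover have "q x + s x \<le> 1" if "x \<in> X" "p x + q x + s x \<le> 1" for x
    using * that by (force simp: predicates_def PiE_iff)
  ultimately show "Option.bind (osum (predicates X) q s) (osum (predicates X) p)
      = Option.bind (osum (predicates X) p q) (\<lambda>u. osum (predicates X) u s)"
    by (auto simp: predicates_def fun_eq_iff algebra_simps)
next
  fix p q s
  assume *: "p \<in> carrier (predicates X)" "q \<in> carrier (predicates X)"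
    "osum (predicates X) p q = Some s"
  then have s: "s = (\<lambda>x\<in>X. p x + q x)" "\<forall>x\<in>X. p x + q x \<le> 1"
    by (auto simp: predicates_def split: if_splits)
  show "s \<in> carrier (predicates X)"
    using * s(2) unfolding s(1) by (auto simp: predicates_def PiE_iff)
next
  fix p q
  assume *: "p \<in> carrier (predicates X)" "q \<in> carrier (predicates X)"
    "osum (predicates X) p q = Some (oone (predicates X))"
  show "q = perp (predicates X) p"
  proof (rule extensionalityI[where A = X])
    show "q \<in> extensional X" "perp (predicates X) p \<in> extensional X"
      using * by (auto simp: predicates_def PiE_iff)
    fix x assume "x \<in> X"
    then show "q x = perp (predicates X) p x"
      using *(3) by (auto simp: predicates_def oone_def fun_eq_iff algebra_simps split: if_splits)
  qed
next
  fix p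
  assume *: "p \<in> carrier (predicates X)"
    "osum (predicates X) p (oone (predicates X)) \<noteq> None"
  show "p = ozero (predicates X)"
  proof (rule extensionalityI[where A = X])
    show "p \<in> extensional X" "ozero (predicates X) \<in> extensional X"
      using * by (auto simp: predicates_def PiE_iff)
    fix x assume "x \<in> X"
    then show "p x = ozero (predicates X) x"
      using * by (auto simp: predicates_def oone_def PiE_iff order_antisym split: if_splits)
  qed
next
  fix p q
  show "osum (predicates X) p q = osum (predicates X) q p"
    by (simp add: predicates_def add.commute)
next
  fix p assume "p \<in> carrier (predicates X)"
  then show "osum (predicates X) p (ozero (predicates X)) = Some p"
    by (auto simp: predicates_def PiE_iff intro: extensionalityI[where A = X])
next
  fix p assume "p \<in> carrier (predicates X)"
  then show "scale (predicates X) 1 p = p"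
    by (auto simp: predicates_def PiE_iff intro: extensionalityI[where A = X])
next
  show "ozero (predicates X) \<in> carrier (predicates X)"
    by (simp add: predicates_def)
next
  fix p assume p: "p \<in> carrier (predicates X)"
  then show "perp (predicates X) p \<in> carrier (predicates X)"
    by (simp add: predicates_def PiE_iff)
  show "osum (predicates X) p (perp (predicates X) p) = Some (oone (predicates X))"
    by (auto simp: predicates_def oone_def intro: restrict_ext)
  show "scale (predicates X) (r * s) p = scale (predicates X) r (scale (predicates X) s p)" for r s
    by (auto simp: predicates_def intro: restrict_ext)
qed

section \<open>The expectation monad\<close>

text \<open>Sets are arbitrary (possibly empty) subsets of HOL types, and a morphism from \<open>X\<close> to \<open>Y\<close>
  is given by any \<open>f \<in> X \<rightarrow> Y\<close>.  Its domain and codomain are therefore explicit arguments of the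
  action of a functor.\<close>

definition E :: "'a set \<Rightarrow> (('a \<Rightarrow> real) \<Rightarrow> real) set" where
  "E X = EMod (predicates X) unit_interval"

definition E_map ::
  "'a set \<Rightarrow> 'b set \<Rightarrow> ('a \<Rightarrow> 'b) \<Rightarrow> (('a \<Rightarrow> real) \<Rightarrow> real) \<Rightarrow> (('b \<Rightarrow> real) \<Rightarrow> real)" where
  "E_map X Y f h = (\<lambda>p \<in> carrier (predicates Y). h (compose X p f))"

definition E_unit :: "'a set \<Rightarrow> 'a \<Rightarrow> (('a \<Rightarrow> real) \<Rightarrow> real)" where
  "E_unit X x = (\<lambda>p \<in> carrier (predicates X). p x)"

definition E_mult ::
  "'a set \<Rightarrow> (((('a \<Rightarrow> real) \<Rightarrow> real) \<Rightarrow> real) \<Rightarrow> real) \<Rightarrow> (('a \<Rightarrow> real) \<Rightarrow> real)" where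
  "E_mult X h = (\<lambda>p \<in> carrier (predicates X). h (\<lambda>k \<in> E X. k p))"

lemma carrier_predicates: "carrier (predicates X) = X \<rightarrow>\<^sub>E {0..1}"
  by (simp add: predicates_def)

lemma E_iff:
  "h \<in> E X \<longleftrightarrow>
    h \<in> (X \<rightarrow>\<^sub>E {0..1}) \<rightarrow>\<^sub>E {0..1} \<and>
    h (\<lambda>x\<in>X. 1) = 1 \<and>
    (\<forall>p \<in> X \<rightarrow>\<^sub>E {0..1}. \<forall>q \<in> X \<rightarrow>\<^sub>E {0..1}.
      (\<forall>x\<in>X. p x + q x \<le> 1) \<longrightarrow> h (\<lambda>x\<in>X. p x + q x) = h p + h q) \<and>
    (\<forall>r \<in> {0..1}. \<forall>p \<in> X \<rightarrow>\<^sub>E {0..1}. h (\<lambda>x\<in>X. r * p x) = r * h p)"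
  (is "?L \<longleftrightarrow> ?R")
proof -
  have one: "oone (predicates X) = (\<lambda>x\<in>X. 1)" "oone unit_interval = 1"
    by (auto simp: oone_def predicates_def unit_interval_def fun_eq_iff)
  have sum_le: "h p + h q \<le> 1"
    if "h \<in> (X \<rightarrow>\<^sub>E {0..1}) \<rightarrow>\<^sub>E {0..1}" "p \<in> X \<rightarrow>\<^sub>E {0..1}" "q \<in> X \<rightarrow>\<^sub>E {0..1}"
      "\<forall>x\<in>X. p x + q x \<le> 1" "h (\<lambda>x\<in>X. p x + q x) = h p + h q" for p q
  proof -
    have "(\<lambda>x\<in>X. p x + q x) \<in> X \<rightarrow>\<^sub>E {0..1}"
      using that by (auto simp: PiE_iff)
    then have "h (\<lambda>x\<in>X. p x + q x) \<in> {0..1}"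
      using that(1) by blast
    then show ?thesis
      by (simp add: that)
  qed
  have osum_X: "osum (predicates X) p q = Some s \<longleftrightarrow>
      (\<forall>x\<in>X. p x + q x \<le> 1) \<and> s = (\<lambda>x\<in>X. p x + q x)" for p q s
    by (auto simp: predicates_def)
  have osum_I: "osum unit_interval a b = Some c \<longleftrightarrow> a + b \<le> 1 \<and> c = a + b" for a b c
    by (auto simp: unit_interval_def)
  have scale: "scale (predicates X) r p = (\<lambda>x\<in>X. r * p x)" "scale unit_interval r a = r * a"
    for r p a
    by (simp_all add: predicates_def unit_interval_def)
  have carrier: "carrier unit_interval = {0..1}"
    by (simp add: unit_interval_def)
  have L: "?L \<longleftrightarrow>
    h \<in> (X \<rightarrow>\<^sub>E {0..1}) \<rightarrow>\<^sub>E {0..1} \<and>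
    h (\<lambda>x\<in>X. 1) = 1 \<and>
    (\<forall>p \<in> X \<rightarrow>\<^sub>E {0..1}. \<forall>q \<in> X \<rightarrow>\<^sub>E {0..1}.
      (\<forall>x\<in>X. p x + q x \<le> 1) \<longrightarrow> h p + h q \<le> 1 \<and> h (\<lambda>x\<in>X. p x + q x) = h p + h q) \<and>
    (\<forall>r \<in> {0..1}. \<forall>p \<in> X \<rightarrow>\<^sub>E {0..1}. h (\<lambda>x\<in>X. r * p x) = r * h p)"
    unfolding E_def EMod_def one osum_X osum_I scale carrier carrier_predicates by blast
  show ?thesis
    unfolding L using sum_le by blast
qed

lemma E_map_closed:
  assumes f: "f \<in> X \<rightarrow> Y" and h: "h \<in> E X"
  shows "E_map X Y f h \<in> E Y"
proof -
  have app: "E_map X Y f h p = h (compose X p f)" if "p \<in> Y \<rightarrow>\<^sub>E {0..1}" for p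
    using that by (simp add: E_map_def carrier_predicates)
  have c: "compose X p f \<in> X \<rightarrow>\<^sub>E {0..1}" if "p \<in> Y \<rightarrow>\<^sub>E {0..1}" for p
    using that f by (fastforce simp: compose_def PiE_iff)
  have one: "compose X (\<lambda>y\<in>Y. 1) f = (\<lambda>x\<in>X. 1)"
    using f by (auto simp: compose_def fun_eq_iff)
  have add: "compose X (\<lambda>y\<in>Y. p y + q y) f = (\<lambda>x\<in>X. compose X p f x + compose X q f x)"
    for p q :: "_ \<Rightarrow> real"
    using f by (auto simp: compose_def fun_eq_iff)
  have mult: "compose X (\<lambda>y\<in>Y. r * p y) f = (\<lambda>x\<in>X. r * compose X p f x)" for r :: real and p
    using f by (auto simp: compose_def fun_eq_iff)
  have le: "compose X p f x + compose X q f x \<le> 1"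
    if "\<forall>y\<in>Y. p y + q y \<le> 1" "x \<in> X" for p q :: "_ \<Rightarrow> real" and x
    using that f by (auto simp: compose_def)
  have cl1: "(\<lambda>y\<in>Y. 1::real) \<in> Y \<rightarrow>\<^sub>E {0..1}"
    by simp
  have cl_add: "(\<lambda>y\<in>Y. p y + q y) \<in> Y \<rightarrow>\<^sub>E {0..1}"
    if "p \<in> Y \<rightarrow>\<^sub>E {0..1}" "q \<in> Y \<rightarrow>\<^sub>E {0..1}" "\<forall>y\<in>Y. p y + q y \<le> 1" for p q :: "_ \<Rightarrow> real"
    using that by (auto simp: PiE_iff)
  have cl_mult: "(\<lambda>y\<in>Y. r * p y) \<in> Y \<rightarrow>\<^sub>E {0..1}"
    if "p \<in> Y \<rightarrow>\<^sub>E {0..1}" "r \<in> {0..1}" for r :: real and p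
    using that by (auto simp: PiE_iff mult_le_one)
  note hh = h[unfolded E_iff]
  show ?thesis
    unfolding E_iff
  proof (intro conjI ballI impI)
    show "E_map X Y f h \<in> (Y \<rightarrow>\<^sub>E {0..1}) \<rightarrow>\<^sub>E {0..1}"
    proof (rule PiE_I)
      show "E_map X Y f h p \<in> {0..1}" if "p \<in> Y \<rightarrow>\<^sub>E {0..1}" for p
        using hh c[OF that] unfolding app[OF that] by blast
    qed (simp add: E_map_def carrier_predicates)
    show "E_map X Y f h (\<lambda>x\<in>Y. 1) = 1"
      using hh by (simp only: app[OF cl1] one)
    show "E_map X Y f h (\<lambda>y\<in>Y. p y + q y) = E_map X Y f h p + E_map X Y f h q"
      if "p \<in> Y \<rightarrow>\<^sub>E {0..1}" "q \<in> Y \<rightarrow>\<^sub>E {0..1}" "\<forall>y\<in>Y. p y + q y \<le> 1" for p q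
      using hh c[OF that(1)] c[OF that(2)] le[OF that(3)]
      unfolding app[OF that(1)] app[OF that(2)] app[OF cl_add[OF that]] add by blast
    show "E_map X Y f h (\<lambda>y\<in>Y. r * p y) = r * E_map X Y f h p"
      if "r \<in> {0..1}" "p \<in> Y \<rightarrow>\<^sub>E {0..1}" for r p
      using hh c[OF that(2)] that(1)
      unfolding app[OF that(2)] app[OF cl_mult[OF that(2,1)]] mult by blast
  qed
qed

lemma E_unit_closed:
  assumes x: "x \<in> X"
  shows "E_unit X x \<in> E X"
  unfolding E_iff
proof (intro conjI ballI impI)
  show "E_unit X x \<in> (X \<rightarrow>\<^sub>E {0..1}) \<rightarrow>\<^sub>E {0..1}"
    using x by (auto simp: E_unit_def carrier_predicates)
  show "E_unit X x (\<lambda>x\<in>X. 1) = 1"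
    using x by (simp add: E_unit_def carrier_predicates)
  fix p assume p: "p \<in> X \<rightarrow>\<^sub>E {0..1::real}"
  show "E_unit X x (\<lambda>x\<in>X. r * p x) = r * E_unit X x p" if "r \<in> {0..1}" for r
  proof -
    have "(\<lambda>x\<in>X. r * p x) \<in> X \<rightarrow>\<^sub>E {0..1}"
      using p that by (auto simp: PiE_iff mult_le_one)
    then show ?thesis
      using x p by (simp add: E_unit_def carrier_predicates)
  qed
  show "E_unit X x (\<lambda>x\<in>X. p x + q x) = E_unit X x p + E_unit X x q"
    if "q \<in> X \<rightarrow>\<^sub>E {0..1}" "\<forall>x\<in>X. p x + q x \<le> 1" for q
  proof -
    have "(\<lambda>x\<in>X. p x + q x) \<in> X \<rightarrow>\<^sub>E {0..1}"
      using p that by (auto simp: PiE_iff)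
    then show ?thesis
      using x p that(1) by (simp add: E_unit_def carrier_predicates)
  qed
qed

lemma E_mult_closed:
  assumes h: "h \<in> E (E X)"
  shows "E_mult X h \<in> E X"
proof -
  define ev where "ev p = (\<lambda>k \<in> E X. k p)" for p :: "'a \<Rightarrow> real"
  have app: "E_mult X h p = h (ev p)" if "p \<in> X \<rightarrow>\<^sub>E {0..1}" for p
    using that by (simp add: E_mult_def carrier_predicates ev_def)
  have ev: "ev p \<in> E X \<rightarrow>\<^sub>E {0..1}" if "p \<in> X \<rightarrow>\<^sub>E {0..1}" for p
  proof -
    have "k p \<in> {0..1}" if "k \<in> E X" for k
      using that \<open>p \<in> _\<close> unfolding E_iff by blast
    then show ?thesis by (simp add: ev_def)
  qed
  have ev_one: "ev (\<lambda>x\<in>X. 1) = (\<lambda>k\<in>E X. 1)"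
    unfolding ev_def by (rule restrict_ext) (simp add: E_iff)
  have cl1: "(\<lambda>y\<in>X. 1::real) \<in> X \<rightarrow>\<^sub>E {0..1}"
    by simp
  have cl_add: "(\<lambda>y\<in>X. p y + q y) \<in> X \<rightarrow>\<^sub>E {0..1}"
    if "p \<in> X \<rightarrow>\<^sub>E {0..1}" "q \<in> X \<rightarrow>\<^sub>E {0..1}" "\<forall>y\<in>X. p y + q y \<le> 1" for p q :: "_ \<Rightarrow> real"
    using that by (auto simp: PiE_iff)
  have cl_mult: "(\<lambda>y\<in>X. r * p y) \<in> X \<rightarrow>\<^sub>E {0..1}"
    if "p \<in> X \<rightarrow>\<^sub>E {0..1}" "r \<in> {0..1}" for r :: real and p
    using that by (auto simp: PiE_iff mult_le_one)
  note hh = h[unfolded E_iff[of _ "E X"]]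
  show ?thesis
    unfolding E_iff
  proof (intro conjI ballI impI)
    show "E_mult X h \<in> (X \<rightarrow>\<^sub>E {0..1}) \<rightarrow>\<^sub>E {0..1}"
    proof (rule PiE_I)
      show "E_mult X h p \<in> {0..1}" if "p \<in> X \<rightarrow>\<^sub>E {0..1}" for p
        using hh ev[OF that] unfolding app[OF that] by blast
    qed (simp add: E_mult_def carrier_predicates)
    show "E_mult X h (\<lambda>x\<in>X. 1) = 1"
      using hh by (simp only: app[OF cl1] ev_one)
    show "E_mult X h (\<lambda>x\<in>X. p x + q x) = E_mult X h p + E_mult X h q"
      if pq: "p \<in> X \<rightarrow>\<^sub>E {0..1}" "q \<in> X \<rightarrow>\<^sub>E {0..1}" "\<forall>x\<in>X. p x + q x \<le> 1" for p q
    proof -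
      have k: "k (\<lambda>x\<in>X. p x + q x) = k p + k q" "k (\<lambda>x\<in>X. p x + q x) \<in> {0..1}"
        if "k \<in> E X" for k
        using that pq cl_add[OF pq] unfolding E_iff by blast+
      have "ev (\<lambda>x\<in>X. p x + q x) = (\<lambda>k\<in>E X. ev p k + ev q k)"
        unfolding ev_def by (rule restrict_ext) (simp add: k)
      moreover have "\<forall>k\<in>E X. ev p k + ev q k \<le> 1"
        using k by (simp add: ev_def)
      ultimately show ?thesis
        using hh ev[OF pq(1)] ev[OF pq(2)]
        unfolding app[OF pq(1)] app[OF pq(2)] app[OF cl_add[OF pq]] by simp
    qed
    show "E_mult X h (\<lambda>x\<in>X. r * p x) = r * E_mult X h p"
      if rp: "r \<in> {0..1}" "p \<in> X \<rightarrow>\<^sub>E {0..1}" for r p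
    proof -
      have k: "k (\<lambda>x\<in>X. r * p x) = r * k p" if "k \<in> E X" for k
        using that rp unfolding E_iff by blast
      have "ev (\<lambda>x\<in>X. r * p x) = (\<lambda>k\<in>E X. r * ev p k)"
        unfolding ev_def by (rule restrict_ext) (simp add: k)
      then show ?thesis
        using hh ev[OF rp(2)] rp(1) by (simp only: app rp cl_mult)
    qed
  qed
qed

section \<open>The distribution monad\<close>

text \<open>Sums over a possibly infinite set are taken over the finite support; HOL's \<open>sum\<close> would
  return \<open>0\<close> on an infinite index set.\<close>

definition supp :: "'a set \<Rightarrow> ('a \<Rightarrow> real) \<Rightarrow> 'a set" where
  "supp X \<phi> = {x \<in> X. \<phi> x \<noteq> 0}"

definition D :: "'a set \<Rightarrow> ('a \<Rightarrow> real) set" where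
  "D X = {\<phi> \<in> X \<rightarrow>\<^sub>E {0..1}. finite (supp X \<phi>) \<and> (\<Sum>x\<in>supp X \<phi>. \<phi> x) = 1}"

definition D_map :: "'a set \<Rightarrow> 'b set \<Rightarrow> ('a \<Rightarrow> 'b) \<Rightarrow> ('a \<Rightarrow> real) \<Rightarrow> ('b \<Rightarrow> real)" where
  "D_map X Y f \<phi> = (\<lambda>y\<in>Y. \<Sum>x | x \<in> supp X \<phi> \<and> f x = y. \<phi> x)"

definition D_unit :: "'a set \<Rightarrow> 'a \<Rightarrow> ('a \<Rightarrow> real)" where
  "D_unit X x = (\<lambda>y\<in>X. if y = x then 1 else 0)"

definition D_mult :: "'a set \<Rightarrow> (('a \<Rightarrow> real) \<Rightarrow> real) \<Rightarrow> ('a \<Rightarrow> real)" where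
  "D_mult X \<Psi> = (\<lambda>y\<in>X. \<Sum>\<phi>\<in>supp (D X) \<Psi>. \<Psi> \<phi> * \<phi> y)"

lemma sum_supp_superset:
  assumes "finite A" "supp X \<phi> \<subseteq> A" "A \<subseteq> X"
  shows "(\<Sum>x\<in>supp X \<phi>. \<phi> x * g x) = (\<Sum>x\<in>A. \<phi> x * g x)"
  using assms by (intro sum.mono_neutral_left) (auto simp: supp_def)

lemma D_I:
  assumes "\<phi> \<in> extensional X" "\<And>x. x \<in> X \<Longrightarrow> 0 \<le> \<phi> x"
    and A: "finite A" "supp X \<phi> \<subseteq> A" "A \<subseteq> X" and sum: "sum \<phi> A = 1"
  shows "\<phi> \<in> D X"
proof -
  have "sum \<phi> (supp X \<phi>) = 1"
    using sum_supp_superset[OF A, of "\<lambda>_. 1"] sum by simp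
  moreover have "\<phi> x \<le> 1" if "x \<in> X" for x
  proof (cases "x \<in> A")
    case True
    then have "\<phi> x \<le> sum \<phi> A"
      using A assms(2) by (intro member_le_sum) auto
    then show ?thesis using sum by simp
  next
    case False
    then show ?thesis using that A(2) by (auto simp: supp_def)
  qed
  ultimately show ?thesis
    using assms finite_subset[OF A(2,1)] by (auto simp: D_def PiE_iff)
qed

lemma D_map_closed:
  assumes f: "f \<in> X \<rightarrow> Y" and \<phi>: "\<phi> \<in> D X"
  shows "D_map X Y f \<phi> \<in> D Y"
proof (rule D_I)
  show "D_map X Y f \<phi> \<in> extensional Y"
    by (simp add: D_map_def)
  show "0 \<le> D_map X Y f \<phi> y" if "y \<in> Y" for y
    using that \<phi> by (auto simp: D_map_def D_def supp_def PiE_iff intro!: sum_nonneg)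
  show fin: "finite (f ` supp X \<phi>)"
    using \<phi> by (simp add: D_def)
  show sub: "f ` supp X \<phi> \<subseteq> Y"
    using f by (auto simp: supp_def)
  show "supp Y (D_map X Y f \<phi>) \<subseteq> f ` supp X \<phi>"
    by (force simp: supp_def[of Y] D_map_def intro: sum.neutral elim: sum.not_neutral_contains_not_neutral)
  have "sum (D_map X Y f \<phi>) (f ` supp X \<phi>)
      = (\<Sum>y\<in>f ` supp X \<phi>. \<Sum>x | x \<in> supp X \<phi> \<and> f x = y. \<phi> x)"
    using sub by (intro sum.cong) (auto simp: D_map_def)
  also have "\<dots> = sum \<phi> (supp X \<phi>)"
    using \<phi> by (intro sum.group) (auto simp: D_def)
  finally show "sum (D_map X Y f \<phi>) (f ` supp X \<phi>) = 1"
    using \<phi> by (simp add: D_def)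
qed

lemma D_unit_closed:
  assumes "x \<in> X"
  shows "D_unit X x \<in> D X"
  using assms by (intro D_I[where A = "{x}"]) (auto simp: D_unit_def supp_def)

lemma D_mult_closed:
  assumes \<Psi>: "\<Psi> \<in> D (D X)"
  shows "D_mult X \<Psi> \<in> D X"
proof (rule D_I)
  let ?S = "supp (D X) \<Psi>"
  let ?A = "\<Union>\<phi>\<in>?S. supp X \<phi>"
  have \<Psi>_nonneg: "0 \<le> \<Psi> \<phi>" if "\<phi> \<in> ?S" for \<phi>
    using that \<Psi> by (auto simp: D_def[of "D X"] supp_def PiE_iff)
  have S: "\<phi> \<in> D X" if "\<phi> \<in> ?S" for \<phi>
    using that by (simp add: supp_def)
  show "D_mult X \<Psi> \<in> extensional X"
    by (simp add: D_mult_def)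
  show "0 \<le> D_mult X \<Psi> y" if "y \<in> X" for y
  proof -
    have "0 \<le> \<phi> y" if "\<phi> \<in> ?S" for \<phi>
      using S[OF that] \<open>y \<in> X\<close> by (simp add: D_def PiE_iff)
    then show ?thesis
      using that \<Psi>_nonneg by (simp add: D_mult_def sum_nonneg)
  qed
  show fin: "finite ?A"
  proof (rule finite_UN_I)
    show "finite ?S"
      using \<Psi> unfolding D_def[of "D X"] by blast
    show "finite (supp X \<phi>)" if "\<phi> \<in> ?S" for \<phi>
      using S[OF that] by (simp add: D_def)
  qed
  show sub: "?A \<subseteq> X"
    by (auto simp: supp_def)
  show "supp X (D_mult X \<Psi>) \<subseteq> ?A"
  proof
    fix y assume y: "y \<in> supp X (D_mult X \<Psi>)"
    then have "(\<Sum>\<phi>\<in>?S. \<Psi> \<phi> * \<phi> y) \<noteq> 0"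
      by (auto simp: supp_def D_mult_def)
    then obtain \<phi> where "\<phi> \<in> ?S" "\<Psi> \<phi> * \<phi> y \<noteq> 0"
      by (rule sum.not_neutral_contains_not_neutral)
    then show "y \<in> ?A"
      using y by (auto simp: supp_def[of X])
  qed
  have "sum (D_mult X \<Psi>) ?A = (\<Sum>y\<in>?A. \<Sum>\<phi>\<in>?S. \<Psi> \<phi> * \<phi> y)"
    using sub by (intro sum.cong) (auto simp: D_mult_def)
  also have "\<dots> = (\<Sum>\<phi>\<in>?S. \<Psi> \<phi> * sum \<phi> ?A)"
    by (subst sum.swap) (simp add: sum_distrib_left)
  also have "\<dots> = (\<Sum>\<phi>\<in>?S. \<Psi> \<phi>)"
  proof (rule sum.cong)
    fix \<phi> assume \<phi>: "\<phi> \<in> ?S"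
    then have "supp X \<phi> \<subseteq> ?A"
      by blast
    then have "sum \<phi> ?A = sum \<phi> (supp X \<phi>)"
      using sum_supp_superset[OF fin _ sub, of \<phi> "\<lambda>_. 1"] by simp
    then show "\<Psi> \<phi> * sum \<phi> ?A = \<Psi> \<phi>"
      using S[OF \<phi>] by (simp add: D_def)
  qed simp
  also have "\<dots> = 1"
    using \<Psi> unfolding D_def[of "D X"] by blast
  finally show "sum (D_mult X \<Psi>) ?A = 1" .
qed

section \<open>The comparison map\<close>

definition \<sigma> :: "'a set \<Rightarrow> ('a \<Rightarrow> real) \<Rightarrow> (('a \<Rightarrow> real) \<Rightarrow> real)" where
  "\<sigma> X \<phi> = (\<lambda>p \<in> carrier (predicates X). \<Sum>x\<in>supp X \<phi>. \<phi> x * p x)"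

end

(* Evaluating sigma X phi at the indicator function of {x} recovers phi x, so sigma X is injective.
   For finite X every predicate p is the finite sum of the scalar multiples p x of these indicators,
   so a map h of effect modules is determined by the weights h (indicator of {x}), which add up
   to h 1 = 1 and hence form a distribution. *)

theory Submission
  imports Defs
begin

text \<open>As a function this equals \<open>D_unit X x\<close>, but here it is read as a predicate,
  to be fed to an expectation rather than to serve as a distribution.\<close>

definition point_pred :: "'a set \<Rightarrow> 'a \<Rightarrow> 'a \<Rightarrow> real" where
  "point_pred X x = (\<lambda>y\<in>X. if y = x then 1 else 0)"

lemma point_pred_closed: "point_pred X x \<in> X \<rightarrow>\<^sub>E {0..1}"
  by (auto simp: point_pred_def)

lemma D_D:
  assumes "\<phi> \<in> D X"
  shows "\<phi> \<in> X \<rightarrow>\<^sub>E {0..1}" "finite (supp X \<phi>)" "sum \<phi> (supp X \<phi>) = 1"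
  using assms unfolding D_def by auto

lemma supp_subset: "supp X \<phi> \<subseteq> X"
  by (auto simp: supp_def)

lemma D_nonneg: "\<phi> \<in> D X \<Longrightarrow> x \<in> X \<Longrightarrow> 0 \<le> \<phi> x"
  using D_D(1) by (fastforce simp: PiE_iff)

lemma \<sigma>_apply: "p \<in> X \<rightarrow>\<^sub>E {0..1} \<Longrightarrow> \<sigma> X \<phi> p = (\<Sum>x\<in>supp X \<phi>. \<phi> x * p x)"
  by (simp add: \<sigma>_def carrier_predicates)

text \<open>Enlarging the index set adds only zero terms. Sums for \<open>D_map\<close> and
  \<open>D_mult\<close> can thus run over an image or a union of supports, without computing the
  exact support.\<close>

lemma \<sigma>_apply_superset:
  assumes "p \<in> X \<rightarrow>\<^sub>E {0..1}" "finite A" "supp X \<phi> \<subseteq> A" "A \<subseteq> X"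
  shows "\<sigma> X \<phi> p = (\<Sum>x\<in>A. \<phi> x * p x)"
  using assms by (simp add: \<sigma>_apply sum_supp_superset)

lemma \<sigma>_extensional: "\<sigma> X \<phi> \<in> extensional (X \<rightarrow>\<^sub>E {0..1})"
  by (simp add: \<sigma>_def carrier_predicates)

text \<open>A weighted average of values in the unit interval stays there, because the weights are
  nonnegative and add up to 1. The remaining conditions are linearity of finite sums.\<close>

lemma \<sigma>_closed:
  assumes \<phi>: "\<phi> \<in> D X"
  shows "\<sigma> X \<phi> \<in> E X"
proof -
  let ?S = "supp X \<phi>"
  have SX: "x \<in> X" if "x \<in> ?S" for x
    using that by (simp add: supp_def)
  have one: "(\<lambda>x\<in>X. 1::real) \<in> X \<rightarrow>\<^sub>E {0..1}"
    by simp
  show ?thesis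
    unfolding E_iff
  proof (intro conjI ballI impI)
    show "\<sigma> X \<phi> \<in> (X \<rightarrow>\<^sub>E {0..1}) \<rightarrow>\<^sub>E {0..1}"
    proof (rule PiE_I)
      fix p :: "'a \<Rightarrow> real" assume p: "p \<in> X \<rightarrow>\<^sub>E {0..1}"
      have bounds: "0 \<le> p x" "p x \<le> 1" if "x \<in> ?S" for x
        using p SX[OF that] by (auto simp: PiE_iff)
      have "(\<Sum>x\<in>?S. \<phi> x * p x) \<le> sum \<phi> ?S"
        using bounds D_nonneg[OF \<phi>] SX by (intro sum_mono mult_left_le) auto
      moreover have "0 \<le> (\<Sum>x\<in>?S. \<phi> x * p x)"
        using bounds D_nonneg[OF \<phi>] SX by (intro sum_nonneg mult_nonneg_nonneg) auto
      ultimately show "\<sigma> X \<phi> p \<in> {0..1}"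
        using D_D(3)[OF \<phi>] by (simp add: \<sigma>_apply[OF p])
    qed (simp add: \<sigma>_def carrier_predicates)
    show "\<sigma> X \<phi> (\<lambda>x\<in>X. 1) = 1"
      using D_D(3)[OF \<phi>] SX unfolding \<sigma>_apply[OF one] by simp
    fix p :: "'a \<Rightarrow> real" assume p: "p \<in> X \<rightarrow>\<^sub>E {0..1}"
    show "\<sigma> X \<phi> (\<lambda>x\<in>X. r * p x) = r * \<sigma> X \<phi> p" if r: "r \<in> {0..1}" for r
    proof -
      \<comment> \<open>\<open>\<sigma> X \<phi>\<close> is undefined off the predicates, so its
        argument must be shown to be one before it can be evaluated.\<close>
      have "(\<lambda>x\<in>X. r * p x) \<in> X \<rightarrow>\<^sub>E {0..1}"
        using p r by (auto simp: PiE_iff mult_le_one)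
      then show ?thesis
        using SX by (simp add: \<sigma>_apply p sum_distrib_left mult.left_commute)
    qed
    show "\<sigma> X \<phi> (\<lambda>x\<in>X. p x + q x) = \<sigma> X \<phi> p + \<sigma> X \<phi> q"
      if q: "q \<in> X \<rightarrow>\<^sub>E {0..1}" "\<forall>x\<in>X. p x + q x \<le> 1" for q
    proof -
      have "(\<lambda>x\<in>X. p x + q x) \<in> X \<rightarrow>\<^sub>E {0..1}"
        using p q by (auto simp: PiE_iff)
      then show ?thesis
        using SX by (simp add: \<sigma>_apply p q(1) distrib_left sum.distrib)
    qed
  qed
qed

text \<open>This is change of variables: a sum over the support of \<open>\<phi>\<close> is grouped
  by the fibres of \<open>f\<close>.\<close>

lemma \<sigma>_natural:
  assumes f: "f \<in> X \<rightarrow> Y" and \<phi>: "\<phi> \<in> D X"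
  shows "\<sigma> Y (D_map X Y f \<phi>) = E_map X Y f (\<sigma> X \<phi>)"
proof (rule extensionalityI[OF \<sigma>_extensional])
  show "E_map X Y f (\<sigma> X \<phi>) \<in> extensional (Y \<rightarrow>\<^sub>E {0..1})"
    by (simp add: E_map_def carrier_predicates)
  fix p :: "'b \<Rightarrow> real" assume p: "p \<in> Y \<rightarrow>\<^sub>E {0..1}"
  let ?S = "supp X \<phi>"
  have fin: "finite ?S" by (rule D_D(2)[OF \<phi>])
  have SX: "x \<in> X" if "x \<in> ?S" for x
    using that by (simp add: supp_def)
  have sub: "f ` ?S \<subseteq> Y"
    using f by (auto simp: supp_def)
  \<comment> \<open>A nonzero sum over a fibre has a nonzero summand, so the fibre meets the support
    of \<open>\<phi>\<close>.\<close>
  have supp: "supp Y (D_map X Y f \<phi>) \<subseteq> f ` ?S"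
    by (force simp: supp_def[of Y] D_map_def elim: sum.not_neutral_contains_not_neutral)
  have c: "compose X p f \<in> X \<rightarrow>\<^sub>E {0..1}"
    using p f by (fastforce simp: compose_def PiE_iff)
  have "\<sigma> Y (D_map X Y f \<phi>) p = (\<Sum>y\<in>f ` ?S. D_map X Y f \<phi> y * p y)"
    using p fin supp sub by (intro \<sigma>_apply_superset) auto
  also have "\<dots> = (\<Sum>y\<in>f ` ?S. \<Sum>x | x \<in> ?S \<and> f x = y. \<phi> x * p (f x))"
    using sub by (intro sum.cong) (auto simp: D_map_def sum_distrib_right)
  also have "\<dots> = (\<Sum>x\<in>?S. \<phi> x * p (f x))"
    using fin by (intro sum.group) auto
  also have "\<dots> = \<sigma> X \<phi> (compose X p f)"
    unfolding \<sigma>_apply[OF c] using SX by (simp add: compose_def)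
  also have "\<dots> = E_map X Y f (\<sigma> X \<phi>) p"
    using p by (simp add: E_map_def carrier_predicates)
  finally show "\<sigma> Y (D_map X Y f \<phi>) p = E_map X Y f (\<sigma> X \<phi>) p" .
qed

lemma \<sigma>_unit:
  assumes x: "x \<in> X"
  shows "\<sigma> X (D_unit X x) = E_unit X x"
proof (rule extensionalityI[OF \<sigma>_extensional])
  show "E_unit X x \<in> extensional (X \<rightarrow>\<^sub>E {0..1})"
    by (simp add: E_unit_def carrier_predicates)
  have "supp X (D_unit X x) = {x}"
    using x by (auto simp: supp_def D_unit_def)
  then show "\<sigma> X (D_unit X x) p = E_unit X x p" if "p \<in> X \<rightarrow>\<^sub>E {0..1}" for p
    using that x by (simp add: \<sigma>_apply E_unit_def carrier_predicates D_unit_def)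
qed

text \<open>Both sides are the same double sum with the order of summation exchanged. The argument
  of \<open>E_mult X\<close> is the horizontal composite of \<sigma> with itself: first \<sigma> at
  \<open>D X\<close>, then the image of \<open>\<sigma> X\<close> under the functor.\<close>

lemma \<sigma>_mult:
  assumes \<Psi>: "\<Psi> \<in> D (D X)"
  shows "\<sigma> X (D_mult X \<Psi>) = E_mult X (E_map (D X) (E X) (\<sigma> X) (\<sigma> (D X) \<Psi>))"
proof (rule extensionalityI[OF \<sigma>_extensional])
  show "E_mult X (E_map (D X) (E X) (\<sigma> X) (\<sigma> (D X) \<Psi>)) \<in> extensional (X \<rightarrow>\<^sub>E {0..1})"
    by (simp add: E_mult_def carrier_predicates)
  fix p :: "'a \<Rightarrow> real" assume p: "p \<in> X \<rightarrow>\<^sub>E {0..1}"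
  let ?S = "supp (D X) \<Psi>"
  \<comment> \<open>One finite index set for all \<open>\<phi>\<close> in \<open>?S\<close>: the
    inner range no longer depends on \<open>\<phi>\<close>, so the sums can be swapped.\<close>
  let ?A = "\<Union>\<phi>\<in>?S. supp X \<phi>"
  let ?ev = "\<lambda>k\<in>E X. k p"
  have S: "\<phi> \<in> D X" if "\<phi> \<in> ?S" for \<phi>
    using that by (simp add: supp_def)
  have fin: "finite ?A"
    using D_D(2)[OF \<Psi>] D_D(2)[OF S] by blast
  have sub: "?A \<subseteq> X"
    by (auto simp: supp_def)
  have supp: "supp X (D_mult X \<Psi>) \<subseteq> ?A"
    by (force simp: supp_def[of X] D_mult_def elim: sum.not_neutral_contains_not_neutral)
  have ev: "?ev \<in> E X \<rightarrow>\<^sub>E {0..1}"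
  proof -
    have "k p \<in> {0..1}" if "k \<in> E X" for k
      using that p unfolding E_iff by blast
    then show ?thesis by simp
  qed
  \<comment> \<open>Evaluation at \<open>p\<close>, pulled back along \<open>\<sigma> X\<close>, is
    the predicate sending \<open>\<phi>\<close> to the expected value of \<open>p\<close>. Since
    \<open>?ev\<close> is undefined outside \<open>E X\<close>, this relies on
    \<open>\<sigma>_closed\<close>.\<close>
  have c: "compose (D X) ?ev (\<sigma> X) = (\<lambda>\<phi>\<in>D X. \<sigma> X \<phi> p)"
    by (auto simp: compose_def \<sigma>_closed)
  have c_closed: "(\<lambda>\<phi>\<in>D X. \<sigma> X \<phi> p) \<in> D X \<rightarrow>\<^sub>E {0..1}"
  proof -
    have "\<sigma> X \<phi> p \<in> {0..1}" if "\<phi> \<in> D X" for \<phi>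
      using \<sigma>_closed[OF that] p unfolding E_iff by blast
    then show ?thesis by simp
  qed
  have "\<sigma> X (D_mult X \<Psi>) p = (\<Sum>y\<in>?A. D_mult X \<Psi> y * p y)"
    by (rule \<sigma>_apply_superset[OF p fin supp sub])
  also have "\<dots> = (\<Sum>y\<in>?A. \<Sum>\<phi>\<in>?S. \<Psi> \<phi> * (\<phi> y * p y))"
    using sub by (intro sum.cong) (auto simp: D_mult_def sum_distrib_right mult.assoc)
  also have "\<dots> = (\<Sum>\<phi>\<in>?S. \<Psi> \<phi> * (\<Sum>y\<in>?A. \<phi> y * p y))"
    by (subst sum.swap) (simp add: sum_distrib_left)
  also have "\<dots> = (\<Sum>\<phi>\<in>?S. \<Psi> \<phi> * \<sigma> X \<phi> p)"
  proof (rule sum.cong)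
    fix \<phi> assume "\<phi> \<in> ?S"
    then have "supp X \<phi> \<subseteq> ?A"
      by blast
    then show "\<Psi> \<phi> * (\<Sum>y\<in>?A. \<phi> y * p y) = \<Psi> \<phi> * \<sigma> X \<phi> p"
      by (simp only: \<sigma>_apply_superset[OF p fin _ sub])
  qed simp
  also have "\<dots> = \<sigma> (D X) \<Psi> (\<lambda>\<phi>\<in>D X. \<sigma> X \<phi> p)"
    using S by (simp add: \<sigma>_apply[OF c_closed])
  also have "\<dots> = E_map (D X) (E X) (\<sigma> X) (\<sigma> (D X) \<Psi>) ?ev"
    using ev by (simp add: E_map_def carrier_predicates c)
  also have "\<dots> = E_mult X (E_map (D X) (E X) (\<sigma> X) (\<sigma> (D X) \<Psi>)) p"
    using p by (simp add: E_mult_def carrier_predicates)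
  finally show "\<sigma> X (D_mult X \<Psi>) p
      = E_mult X (E_map (D X) (E X) (\<sigma> X) (\<sigma> (D X) \<Psi>)) p" .
qed

lemma \<sigma>_point_pred:
  assumes "\<phi> \<in> D X" "x \<in> X"
  shows "\<sigma> X \<phi> (point_pred X x) = \<phi> x"
proof -
  \<comment> \<open>Inserting \<open>x\<close> treats the cases of zero and nonzero
    \<open>\<phi> x\<close> alike: the term at \<open>x\<close> is always present, and all others
    vanish.\<close>
  have "\<sigma> X \<phi> (point_pred X x) = (\<Sum>y\<in>insert x (supp X \<phi>). \<phi> y * point_pred X x y)"
    using assms D_D(2)[OF assms(1)] supp_subset[of X \<phi>]
    by (intro \<sigma>_apply_superset point_pred_closed) auto
  also have "\<dots> = (\<Sum>y\<in>{x}. \<phi> y * point_pred X x y)"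
    using D_D(2)[OF assms(1)] by (intro sum.mono_neutral_right) (auto simp: point_pred_def supp_def)
  finally show ?thesis
    using assms by (simp add: point_pred_def)
qed

lemma inj_on_\<sigma>: "inj_on (\<sigma> X) (D X)"
proof (rule inj_onI)
  fix \<phi> \<psi> assume *: "\<phi> \<in> D X" "\<psi> \<in> D X" "\<sigma> X \<phi> = \<sigma> X \<psi>"
  show "\<phi> = \<psi>"
  proof (rule PiE_ext[OF D_D(1) D_D(1)])
    show "\<phi> x = \<psi> x" if "x \<in> X" for x
      using * that \<sigma>_point_pred by metis
  qed (fact *)+
qed

text \<open>Additivity of \<open>h\<close> concerns two summands at a time, so the points of
  \<open>A\<close> are added one by one. Padding with 0 keeps each partial sum below
  \<open>p\<close>, hence a predicate.\<close>

lemma E_finite_restriction: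
  assumes h: "h \<in> E X" and p: "p \<in> X \<rightarrow>\<^sub>E {0..1}" and A: "finite A" "A \<subseteq> X"
  shows "h (\<lambda>x\<in>X. if x \<in> A then p x else 0) = (\<Sum>x\<in>A. h (point_pred X x) * p x)"
  using A
proof (induction A)
  case empty
  \<comment> \<open>Preservation of 0 is not among the conditions in \<open>E_iff\<close>; it
    follows from homogeneity with factor 0.\<close>
  have "(0::real) \<in> {0..1}"
    by simp
  then have "h (\<lambda>x\<in>X. 0 * p x) = 0 * h p"
    using h p unfolding E_iff by blast
  moreover have "(\<lambda>x\<in>X. if x \<in> {} then p x else 0) = (\<lambda>x\<in>X. 0 * p x)"
    by (rule restrict_ext) simp
  ultimately show ?case
    by (simp only: sum.empty mult_zero_left)
next
  case (insert a A)
  let ?q = "\<lambda>x\<in>X. if x \<in> A then p x else 0"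
  let ?s = "\<lambda>x\<in>X. p a * point_pred X a x"
  have pa: "p a \<in> {0..1}"
    using p insert.prems by auto
  have q: "?q \<in> X \<rightarrow>\<^sub>E {0..1}"
    using p by (auto simp: PiE_iff)
  have s: "?s \<in> X \<rightarrow>\<^sub>E {0..1}"
    using pa by (auto simp: point_pred_def)
  \<comment> \<open>As \<open>a\<close> lies outside \<open>A\<close>, at most one of the two
    summands is nonzero at each point, so their sum is defined.\<close>
  have le: "\<forall>x\<in>X. ?s x + ?q x \<le> 1"
    using p pa insert.hyps by (auto simp: point_pred_def PiE_iff)
  have "(\<lambda>x\<in>X. if x \<in> insert a A then p x else 0) = (\<lambda>x\<in>X. ?s x + ?q x)"
    using insert.hyps by (auto simp: point_pred_def intro!: restrict_ext)
  then have "h (\<lambda>x\<in>X. if x \<in> insert a A then p x else 0) = h (\<lambda>x\<in>X. ?s x + ?q x)"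
    by (rule arg_cong)
  also have "\<dots> = h ?s + h ?q"
    using h s q le unfolding E_iff by blast
  also have "h ?s = p a * h (point_pred X a)"
    using h pa point_pred_closed[of X a] unfolding E_iff by blast
  finally show ?case
    using insert by (simp add: mult.commute)
qed

text \<open>Take \<open>A = X\<close> above: \<open>p\<close> is extensional, so padding it with 0
  inside \<open>X\<close> changes nothing.\<close>

lemma E_finite_sum:
  assumes "h \<in> E X" "p \<in> X \<rightarrow>\<^sub>E {0..1}" "finite X"
  shows "h p = (\<Sum>x\<in>X. h (point_pred X x) * p x)"
proof -
  have "(\<lambda>x\<in>X. if x \<in> X then p x else 0) = p"
    using assms(2) by (auto simp: fun_eq_iff PiE_iff extensional_def)
  then show ?thesis
    using E_finite_restriction[OF assms(1,2,3)] by simp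
qed

lemma \<sigma>_surj_finite:
  assumes h: "h \<in> E X" and X: "finite X"
  shows "h \<in> \<sigma> X ` D X"
proof
  \<comment> \<open>By \<open>\<sigma>_point_pred\<close> these weights are forced: no other
    distribution can be a preimage of \<open>h\<close>.\<close>
  define \<phi> where "\<phi> = (\<lambda>x\<in>X. h (point_pred X x))"
  have one: "(\<lambda>x\<in>X. 1::real) \<in> X \<rightarrow>\<^sub>E {0..1}"
    by simp
  show "\<phi> \<in> D X"
  proof (rule D_I[where A = X])
    show "0 \<le> \<phi> x" if "x \<in> X" for x
    proof -
      have "h (point_pred X x) \<in> {0..1}"
        using h point_pred_closed[of X x] unfolding E_iff by blast
      then show ?thesis
        using that by (simp add: \<phi>_def)
    qed
    \<comment> \<open>Expanding the constant predicate 1 into indicators turns preservation of 1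
      into normalisation of the weights.\<close>
    have "h (\<lambda>x\<in>X. 1) = 1"
      using h by (simp add: E_iff)
    then show "sum \<phi> X = 1"
      using E_finite_sum[OF h one X] by (simp add: \<phi>_def)
  qed (simp_all add: X supp_subset, simp add: \<phi>_def)
  show "h = \<sigma> X \<phi>"
  proof (rule extensionalityI[OF _ \<sigma>_extensional])
    show "h \<in> extensional (X \<rightarrow>\<^sub>E {0..1})"
      using h by (simp add: E_iff PiE_iff)
    show "h p = \<sigma> X \<phi> p" if p: "p \<in> X \<rightarrow>\<^sub>E {0..1}" for p
      using E_finite_sum[OF h p X] \<sigma>_apply_superset[OF p X supp_subset subset_refl, of \<phi>]
      by (simp add: \<phi>_def)
  qed
qed

text \<open>Empty \<open>X\<close> is included: an empty sum of weights is not 1, so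
  \<open>D X\<close> is empty, and the only predicate is both 0 and 1, so \<open>E X\<close> is
  empty too.\<close>

lemma bij_betw_\<sigma>:
  assumes "finite X"
  shows "bij_betw (\<sigma> X) (D X) (E X)"
  unfolding bij_betw_def using inj_on_\<sigma> \<sigma>_closed \<sigma>_surj_finite[OF _ assms] by blast

theorem lemma21:
  shows
    "(\<forall>X :: 'a set. \<sigma> X \<in> D X \<rightarrow> E X) \<and>
     (\<forall>(X :: 'a set) (Y :: 'b set). \<forall>f \<in> X \<rightarrow> Y. \<forall>\<phi> \<in> D X.
        \<sigma> Y (D_map X Y f \<phi>) = E_map X Y f (\<sigma> X \<phi>)) \<and>
     (\<forall>X :: 'a set. \<forall>x \<in> X. \<sigma> X (D_unit X x) = E_unit X x) \<and>
     (\<forall>X :: 'a set. \<forall>\<Psi> \<in> D (D X).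
        \<sigma> X (D_mult X \<Psi>) = E_mult X (E_map (D X) (E X) (\<sigma> X) (\<sigma> (D X) \<Psi>))) \<and>
     (\<forall>X :: 'a set. inj_on (\<sigma> X) (D X)) \<and>
     (\<forall>X :: 'a set. finite X \<longrightarrow> bij_betw (\<sigma> X) (D X) (E X))"
  by (simp add: \<sigma>_closed \<sigma>_natural \<sigma>_unit \<sigma>_mult inj_on_\<sigma> bij_betw_\<sigma>)

end
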